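(* Let $\mathscr{S}$ be a basis of shapes in a domain $\Omega\subset\mathbb{R}^n$. Assume that $\mathscr{S}$ satisfies the density condition, and that there is a constant $c$ such that for every rearrangeable $f\in\mathrm{BMO}_{\mathscr{S}}(\Omega)$ one has $f^*\in\mathrm{BMO}(0,|\Omega|)$ with $$\|f^*\|_{\mathrm{BMO}}\le c\,\|f\|_{\mathrm{BMO}_{\mathscr{S}}}.$$ Then $f^*\in\mathrm{VMO}(0,|\Omega|)$ for every rearrangeable $f\in\mathrm{VMO}_{\mathscr{S}}(\Omega)$.
   Context: $|\cdot|$ is Lebesgue measure. A basis of shapes in a domain $\Omega\subset\mathbb{R}^n$ is a collection $\mathscr{S}$ of open sets $S\subset\Omega$ with $0<|S|<\infty$ that covers $\Omega$. For $f\in L^1(S)$ real-valued, $f_S=\frac1{|S|}\int_S f$ and $\mathcal{O}(f,S)=\frac1{|S|}\int_S|f-f_S|$. $\mathrm{BMO}_{\mathscr{S}}(\Omega)$ is the set of real-valued $f$ with $f\in L^1(S)$ for all $S\in\mathscr{S}$ and $\|f\|_{\mathrm{BMO}_{\mathscr{S}}}:=\sup_{S\in\mathscr{S}}\mathcal{O}(f,S)<\infty$ (a seminorm; functions are not identified modulo constants). $\mathrm{VMO}_{\mathscr{S}}(\Omega)$ is the set of $f\in\mathrm{BMO}_{\mathscr{S}}(\Omega)$ with $\lim_{\delta\to0^+}\sup_{S\in\mathscr{S},\,|S|\le\delta}\mathcal{O}(f,S)=0$. For an open interval $I\subset\mathbb{R}$ (possibly infinite), $\mathrm{BMO}(I)$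 and $\mathrm{VMO}(I)$ are these spaces for the basis of all finite open intervals contained in $I$. Density condition on $\mathscr{S}$: there exists $q\in(0,\frac14]$ such that for every measurable $E\subset\Omega$ with $|E|>0$ and $|\Omega\setminus E|>0$, $$\limsup_{S\in\mathscr{S},\,|S|\to0}\rho(E,S)(1-\rho(E,S))\ge q,\qquad \rho(E,S)=\frac{|E\cap S|}{|S|}$$ (in particular, shapes of arbitrarily small measure exist). For measurable $f$ on $\Omega$, $\mu_f(\alpha)=|\{x\in\Omega:|f(x)|>\alpha\}|$ for $\alpha\ge0$; $f$ is rearrangeable if $\mu_f(\alpha)\to0$ as $\alpha\to\infty$; and the decreasing rearrangement is $f^*(s)=|\{\alpha\ge0:\mu_f(\alpha)>s\}|$ for $s\in(0,|\Omega|)$ (with $(0,|\Omega|)=\mathbb{R}_+=(0,\infty)$ if $|\Omega|=\infty$). *)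

theory Defs
  imports "HOL-Analysis.Analysis"
begin

text \<open>
  A real-valued function on a subset of a Euclidean space is a total function whose values
  off that subset are never used.
\<close>

definition shape_basis :: "'a::euclidean_space set \<Rightarrow> 'a set set \<Rightarrow> bool" where
  "shape_basis \<Omega> \<S> \<longleftrightarrow>
     (\<forall>S\<in>\<S>. open S \<and> S \<subseteq> \<Omega> \<and> 0 < emeasure lebesgue S \<and> emeasure lebesgue S < \<infinity>)
     \<and> \<Omega> \<subseteq> \<Union>\<S>"

definition mean :: "('a::euclidean_space \<Rightarrow> real) \<Rightarrow> 'a set \<Rightarrow> real" where
  "mean f S = (1 / measure lebesgue S) * (LINT x:S|lebesgue. f x)"

definition mean_osc :: "('a::euclidean_space \<Rightarrow> real) \<Rightarrow> 'a set \<Rightarrow> real" where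
  "mean_osc f S = (1 / measure lebesgue S) * (LINT x:S|lebesgue. \<bar>f x - mean f S\<bar>)"

text \<open>
  The supremum is taken in \<open>[0, \<infinity>]\<close>, so that finiteness is a statement about the supremum
  itself, and the supremum over an empty family is \<open>0\<close>.
\<close>

definition bmo_norm :: "'a::euclidean_space set set \<Rightarrow> ('a \<Rightarrow> real) \<Rightarrow> ennreal" where
  "bmo_norm \<S> f = (SUP S\<in>\<S>. ennreal (mean_osc f S))"

definition BMO :: "'a::euclidean_space set set \<Rightarrow> ('a \<Rightarrow> real) set" where
  "BMO \<S> = {f. (\<forall>S\<in>\<S>. set_integrable lebesgue S f) \<and> bmo_norm \<S> f < \<infinity>}"

definition VMO :: "'a::euclidean_space set set \<Rightarrow> ('a \<Rightarrow> real) set" where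
  "VMO \<S> = {f \<in> BMO \<S>.
     ((\<lambda>\<delta>::real. SUP S\<in>{S\<in>\<S>. measure lebesgue S \<le> \<delta>}. ennreal (mean_osc f S))
        \<longlongrightarrow> 0) (at_right 0)}"

definition intervals_in :: "real set \<Rightarrow> real set set" where
  "intervals_in I = {J. \<exists>a b. a < b \<and> J = {a<..<b} \<and> J \<subseteq> I}"

definition density_in :: "'a::euclidean_space set \<Rightarrow> 'a set \<Rightarrow> real" where
  "density_in E S = measure lebesgue (E \<inter> S) / measure lebesgue S"

text \<open>
  The filter of shapes whose measure tends to \<open>0\<close>.  If the measures of the shapes are bounded
  away from \<open>0\<close>, it is the trivial filter \<open>bot\<close>, along which every \<open>Limsup\<close> in
  \<^typ>\<open>ereal\<close> is \<open>-\<infinity>\<close>; the density condition then fails.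
\<close>

definition small_shapes :: "'a::euclidean_space set set \<Rightarrow> 'a set filter" where
  "small_shapes \<S> = inf (filtercomap (measure lebesgue) (at_right 0)) (principal \<S>)"

definition density_condition :: "'a::euclidean_space set \<Rightarrow> 'a set set \<Rightarrow> bool" where
  "density_condition \<Omega> \<S> \<longleftrightarrow>
     (\<exists>q::real. 0 < q \<and> q \<le> 1/4 \<and>
        (\<forall>E. E \<in> sets lebesgue \<and> E \<subseteq> \<Omega> \<and>
             0 < emeasure lebesgue E \<and> 0 < emeasure lebesgue (\<Omega> - E) \<longrightarrow>
             ereal q \<le> Limsup (small_shapes \<S>) (\<lambda>S. ereal (density_in E S * (1 - density_in E S)))))"

definition distribution_fun :: "'a::euclidean_space set \<Rightarrow> ('a \<Rightarrow> real) \<Rightarrow> real \<Rightarrow> ennreal" where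
  "distribution_fun \<Omega> f \<alpha> = emeasure lebesgue {x\<in>\<Omega>. \<bar>f x\<bar> > \<alpha>}"

definition rearrangeable :: "'a::euclidean_space set \<Rightarrow> ('a \<Rightarrow> real) \<Rightarrow> bool" where
  "rearrangeable \<Omega> f \<longleftrightarrow>
     f \<in> borel_measurable (lebesgue_on \<Omega>) \<and> (distribution_fun \<Omega> f \<longlongrightarrow> 0) at_top"

text \<open>
  For rearrangeable \<open>f\<close> and \<open>s > 0\<close> the set below is a bounded interval, so the real-valued
  \<^const>\<open>measure\<close> loses nothing.
\<close>

definition decreasing_rearrangement ::
    "'a::euclidean_space set \<Rightarrow> ('a \<Rightarrow> real) \<Rightarrow> real \<Rightarrow> real" where
  "decreasing_rearrangement \<Omega> f s =
     measure lebesgue {\<alpha>::real. 0 \<le> \<alpha> \<and> distribution_fun \<Omega> f \<alpha> > ennreal s}"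

text \<open>The interval \<open>(0, |\<Omega>|)\<close>, which is \<open>(0, \<infinity>)\<close> when \<open>|\<Omega>| = \<infinity>\<close>.\<close>

definition measure_interval :: "'a::euclidean_space set \<Rightarrow> real set" where
  "measure_interval \<Omega> = {s. 0 < s \<and> ennreal s < emeasure lebesgue \<Omega>}"

end

(* Write F = f*, f_k = max(|f| - k) 0, and split F = min F k + max (F - k) 0 on (0, |\<Omega>|).
   The second summand is the rearrangement of f_k, so its BMO norm is at most c times that of
   f_k, which tends to 0 as k grows: on small shapes f_k oscillates at most twice as much as f,
   and on the others its average is controlled by the integral of f_k over \<Omega>, which is a tail
   of the integral of F near 0, finite because F lies in BMO.  The first summand is uniformly
   continuous: by the density condition a gap a < b in the essential range of |f| would make f
   oscillate by a fixed amount on arbitrarily small shapes, so each slab a < |f| \<le> b that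
   separates two nonnull sets has positive measure, and F needs at least that much room to
   descend from b to a. *)

theory Submission imports Defs begin

section \<open>Mean oscillation and 1-Lipschitz maps\<close>

lemma set_lebesgue_integral_eq_lebesgue_on:
  fixes f :: "'a::euclidean_space \<Rightarrow> real"
  assumes "S \<in> sets lebesgue"
  shows "(LINT x:S|lebesgue. f x) = integral\<^sup>L (lebesgue_on S) f"
  using assms by (simp add: set_lebesgue_integral_def integral_restrict_space)

text \<open>Replacing c by the mean costs at most |mean f S - c|, which is itself bounded by the
  average of |f - c|. Oscillation can thus be estimated with any convenient constant, at the price
  of a factor 2.\<close>

lemma mean_osc_le_twice:
  fixes f :: "'a::euclidean_space \<Rightarrow> real"
  assumes S: "S \<in> sets lebesgue" "emeasure lebesgue S < \<infinity>" "0 < measure lebesgue S"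
    and f: "set_integrable lebesgue S f"
  shows "mean_osc f S \<le> 2 * ((1 / measure lebesgue S) * (LINT x:S|lebesgue. \<bar>f x - c\<bar>))"
proof -
  let ?M = "lebesgue_on S" and ?m = "measure lebesgue S"
  interpret finite_measure ?M
    using S by (intro finite_measureI) (auto simp: emeasure_restrict_space)
  have i: "integrable ?M f"
    using f S by (simp add: set_integrable_eq)
  have [simp]: "measure ?M (space ?M) = ?m" "measure ?M S = ?m"
    using S by (simp_all add: measure_restrict_space)
  define A where "A = (LINT x|?M. \<bar>f x - c\<bar>)"
  have "mean f S - c = (1 / ?m) * (LINT x|?M. f x - c)"
    using S i by (simp add: mean_def set_lebesgue_integral_eq_lebesgue_on field_simps)
  then have "\<bar>mean f S - c\<bar> = (1 / ?m) * \<bar>LINT x|?M. f x - c\<bar>"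
    using S by (simp add: abs_mult)
  also have "\<dots> \<le> (1 / ?m) * A"
    unfolding A_def using S by (intro mult_left_mono integral_abs_bound) simp
  finally have mc: "\<bar>mean f S - c\<bar> \<le> (1 / ?m) * A" .
  have "(LINT x|?M. \<bar>f x - mean f S\<bar>) \<le> (LINT x|?M. \<bar>f x - c\<bar> + (1 / ?m) * A)"
    using mc by (intro integral_mono) (use i in auto)
  also have "\<dots> = A + ?m * ((1 / ?m) * A)"
    using i by (subst Bochner_Integration.integral_add) (auto simp: A_def)
  also have "\<dots> = 2 * A" using S by simp
  finally have "(1 / ?m) * (LINT x|?M. \<bar>f x - mean f S\<bar>) \<le> (1 / ?m) * (2 * A)"
    using S by (intro mult_left_mono) auto
  then show ?thesis
    using S by (simp add: mean_osc_def set_lebesgue_integral_eq_lebesgue_on A_def mult_ac)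
qed

lemma mean_osc_nonneg: "0 \<le> mean_osc f S"
  unfolding mean_osc_def set_lebesgue_integral_def
  by (intro mult_nonneg_nonneg Bochner_Integration.integral_nonneg) auto

text \<open>A 1-Lipschitz map is dominated by |\<phi> 0| + |y|, and constants are integrable on a
  set of finite measure.\<close>

lemma set_integrable_1_lipschitz_comp:
  fixes f :: "'a::euclidean_space \<Rightarrow> real" and \<phi> :: "real \<Rightarrow> real"
  assumes S: "S \<in> sets lebesgue" "emeasure lebesgue S < \<infinity>"
    and f: "set_integrable lebesgue S f"
    and lip: "\<And>x y. \<bar>\<phi> x - \<phi> y\<bar> \<le> \<bar>x - y\<bar>"
  shows "set_integrable lebesgue S (\<lambda>x. \<phi> (f x))"
proof -
  let ?M = "lebesgue_on S"
  interpret finite_measure ?M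
    using S by (intro finite_measureI) (auto simp: emeasure_restrict_space)
  have i: "integrable ?M f"
    using f S by (simp add: set_integrable_eq)
  have "1-lipschitz_on UNIV \<phi>"
    unfolding lipschitz_on_def dist_real_def using lip by simp
  then have "continuous_on UNIV \<phi>"
    by (rule lipschitz_on_continuous_on)
  then have "\<phi> \<in> borel_measurable borel"
    by (rule borel_measurable_continuous_onI)
  then have [measurable]: "(\<lambda>x. \<phi> (f x)) \<in> borel_measurable ?M"
    using i by (intro measurable_compose[of f ?M borel \<phi>]) auto
  have bound: "\<bar>\<phi> y\<bar> \<le> \<bar>\<phi> 0\<bar> + \<bar>y\<bar>" for y
    using lip[of y 0] by linarith
  have "integrable ?M (\<lambda>x. \<bar>\<phi> 0\<bar> + \<bar>f x\<bar>)"
    using i by simp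
  then have "integrable ?M (\<lambda>x. \<phi> (f x))"
  proof (rule Bochner_Integration.integrable_bound)
    show "AE x in ?M. norm (\<phi> (f x)) \<le> norm (\<bar>\<phi> 0\<bar> + \<bar>f x\<bar>)"
      using bound by (intro AE_I2) (metis abs_ge_self order_trans real_norm_def)
  qed measurable
  then show ?thesis
    using S by (simp add: set_integrable_eq)
qed

text \<open>The oscillation of the composition is measured from the constant
  \<open>\<phi> (mean f S)\<close>, where the Lipschitz condition compares the integrands pointwise;
  the factor 2 pays for not using the true mean.\<close>

lemma mean_osc_1_lipschitz_comp:
  fixes f :: "'a::euclidean_space \<Rightarrow> real" and \<phi> :: "real \<Rightarrow> real"
  assumes S: "S \<in> sets lebesgue" "emeasure lebesgue S < \<infinity>" "0 < measure lebesgue S"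
    and f: "set_integrable lebesgue S f"
    and lip: "\<And>x y. \<bar>\<phi> x - \<phi> y\<bar> \<le> \<bar>x - y\<bar>"
  shows "mean_osc (\<lambda>x. \<phi> (f x)) S \<le> 2 * mean_osc f S"
proof -
  let ?M = "lebesgue_on S" and ?m = "measure lebesgue S"
  interpret finite_measure ?M
    using S by (intro finite_measureI) (auto simp: emeasure_restrict_space)
  have i: "integrable ?M f"
    using f S by (simp add: set_integrable_eq)
  note \<phi>f = set_integrable_1_lipschitz_comp[OF S(1,2) f lip]
  then have i2: "integrable ?M (\<lambda>x. \<phi> (f x))"
    using S by (simp add: set_integrable_eq)
  have "mean_osc (\<lambda>x. \<phi> (f x)) S
      \<le> 2 * ((1 / ?m) * (LINT x:S|lebesgue. \<bar>\<phi> (f x) - \<phi> (mean f S)\<bar>))"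
    by (rule mean_osc_le_twice[OF S \<phi>f])
  also have "(LINT x:S|lebesgue. \<bar>\<phi> (f x) - \<phi> (mean f S)\<bar>)
      \<le> (LINT x:S|lebesgue. \<bar>f x - mean f S\<bar>)"
    unfolding set_lebesgue_integral_eq_lebesgue_on[OF S(1)]
    by (rule integral_mono) (use i i2 lip in auto)
  finally show ?thesis
    using S by (simp add: mean_osc_def divide_right_mono)
qed

section \<open>Distribution function and decreasing rearrangement\<close>

lemma sets_lebesgue_Collect_on:
  fixes f :: "'a::euclidean_space \<Rightarrow> real"
  assumes f: "f \<in> borel_measurable (lebesgue_on \<Omega>)" and \<Omega>: "\<Omega> \<in> sets lebesgue"
    and P: "{y. P y} \<in> sets borel"
  shows "{x \<in> \<Omega>. P (f x)} \<in> sets lebesgue"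
proof -
  have "f -` {y. P y} \<inter> space (lebesgue_on \<Omega>) \<in> sets (lebesgue_on \<Omega>)"
    using f P by (rule measurable_sets)
  also have "f -` {y. P y} \<inter> space (lebesgue_on \<Omega>) = {x \<in> \<Omega>. P (f x)}"
    by auto
  finally show ?thesis
    using \<Omega> by (simp add: sets_restrict_space_iff)
qed

lemma sets_abs_greater:
  fixes f :: "'a::euclidean_space \<Rightarrow> real"
  assumes "f \<in> borel_measurable (lebesgue_on \<Omega>)" "\<Omega> \<in> sets lebesgue"
  shows "{x \<in> \<Omega>. \<bar>f x\<bar> > \<alpha>} \<in> sets lebesgue"
  by (rule sets_lebesgue_Collect_on[OF assms]) measurable

lemma distribution_fun_antimono:
  fixes f :: "'a::euclidean_space \<Rightarrow> real"
  assumes "f \<in> borel_measurable (lebesgue_on \<Omega>)" "\<Omega> \<in> sets lebesgue" "\<alpha> \<le> \<beta>"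
  shows "distribution_fun \<Omega> f \<beta> \<le> distribution_fun \<Omega> f \<alpha>"
  unfolding distribution_fun_def
  by (intro emeasure_mono sets_abs_greater assms(1,2)) (use assms(3) in auto)

text \<open>Right continuity of the distribution function, in a form that also covers infinite
  values: the superlevel sets at \<alpha> + 1/(n+1) increase to the one at \<alpha>, and measure is
  continuous from below.\<close>

lemma distribution_fun_greater_right:
  fixes f :: "'a::euclidean_space \<Rightarrow> real"
  assumes f: "f \<in> borel_measurable (lebesgue_on \<Omega>)" "\<Omega> \<in> sets lebesgue"
    and s: "s < distribution_fun \<Omega> f \<alpha>"
  shows "\<exists>\<beta>>\<alpha>. s < distribution_fun \<Omega> f \<beta>"
proof -
  define A where "A n = {x \<in> \<Omega>. \<bar>f x\<bar> > \<alpha> + 1 / real (Suc n)}" for n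
  have U: "{x \<in> \<Omega>. \<bar>f x\<bar> > \<alpha>} = (\<Union>n. A n)"
  proof (intro equalityI subsetI)
    fix x assume x: "x \<in> {x \<in> \<Omega>. \<bar>f x\<bar> > \<alpha>}"
    then have "0 < \<bar>f x\<bar> - \<alpha>" by auto
    then obtain n where "inverse (real (Suc n)) < \<bar>f x\<bar> - \<alpha>"
      using reals_Archimedean by blast
    then show "x \<in> (\<Union>n. A n)"
      using x by (auto simp: A_def inverse_eq_divide intro!: exI[of _ n])
  next
    fix x assume "x \<in> (\<Union>n. A n)"
    then obtain n where "x \<in> \<Omega>" "\<alpha> + 1 / real (Suc n) < \<bar>f x\<bar>" by (auto simp: A_def)
    moreover have "0 < 1 / real (Suc n)" by simp
    ultimately have "x \<in> \<Omega>" "\<alpha> < \<bar>f x\<bar>" by linarith+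
    then show "x \<in> {x \<in> \<Omega>. \<bar>f x\<bar> > \<alpha>}" by simp
  qed
  have "incseq A"
  proof (rule incseq_SucI)
    fix n
    have "1 / real (Suc (Suc n)) \<le> 1 / real (Suc n)" by (intro divide_left_mono) auto
    then show "A n \<subseteq> A (Suc n)" by (auto simp: A_def)
  qed
  then have "(SUP n. emeasure lebesgue (A n)) = emeasure lebesgue (\<Union>n. A n)"
    unfolding A_def by (intro SUP_emeasure_incseq) (auto intro!: sets_abs_greater f)
  then have "s < (SUP n. emeasure lebesgue (A n))"
    using s U by (simp add: distribution_fun_def)
  then obtain n where "s < emeasure lebesgue (A n)"
    by (auto simp: less_SUP_iff)
  then show ?thesis
    by (intro exI[of _ "\<alpha> + 1 / real (Suc n)"]) (simp add: A_def distribution_fun_def)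
qed

lemma decreasing_rearrangement_nonneg: "0 \<le> decreasing_rearrangement \<Omega> f s"
  by (simp add: decreasing_rearrangement_def)

text \<open>The levels whose superlevel set has measure above s form an interval [0, u), so its
  length is u and being below u is the same as belonging to it. All later facts about the
  rearrangement go through this equivalence.\<close>

lemma less_decreasing_rearrangement_iff:
  fixes f :: "'a::euclidean_space \<Rightarrow> real"
  assumes \<Omega>: "\<Omega> \<in> sets lebesgue" and f: "rearrangeable \<Omega> f" and s: "0 < s" and \<alpha>: "0 \<le> \<alpha>"
  shows "\<alpha> < decreasing_rearrangement \<Omega> f s \<longleftrightarrow> ennreal s < distribution_fun \<Omega> f \<alpha>"
proof -
  have m: "f \<in> borel_measurable (lebesgue_on \<Omega>)"
    and lim: "(distribution_fun \<Omega> f \<longlongrightarrow> 0) at_top"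
    using f by (auto simp: rearrangeable_def)
  define A where "A = {\<beta>. 0 \<le> \<beta> \<and> distribution_fun \<Omega> f \<beta> > ennreal s}"
  \<comment> \<open>Rearrangeability enters here: it bounds the set of levels from above.\<close>
  have "eventually (\<lambda>\<beta>. distribution_fun \<Omega> f \<beta> < ennreal s) at_top"
    using s by (intro order_tendstoD(2)[OF lim]) simp
  then obtain K where K: "distribution_fun \<Omega> f \<beta> < ennreal s" if "\<beta> \<ge> K" for \<beta>
    by (auto simp: eventually_at_top_linorder)
  have bdd: "bdd_above A"
  proof (rule bdd_aboveI)
    fix \<beta> assume "\<beta> \<in> A"
    then show "\<beta> \<le> K" using K[of \<beta>] by (auto simp: A_def not_less[symmetric])
  qed
  show ?thesis
  proof (cases "A = {}")
    case True
    then show ?thesis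
    proof -
      have "decreasing_rearrangement \<Omega> f s = 0"
        unfolding decreasing_rearrangement_def A_def[symmetric] True by simp
      then show ?thesis using True \<alpha> by (auto simp: A_def)
    qed
  next
    case False
    \<comment> \<open>The right end is excluded because right continuity puts a larger level of
      \<open>A\<close> above each one; monotonicity of the distribution function fills in everything
      below.\<close>
    have "A = {0..<Sup A}"
    proof (intro equalityI subsetI)
      fix x assume x: "x \<in> A"
      then obtain y where "x < y" "ennreal s < distribution_fun \<Omega> f y"
        using distribution_fun_greater_right[OF m \<Omega>] by (auto simp: A_def)
      with x have "y \<in> A" by (auto simp: A_def)
      then have "y \<le> Sup A" using bdd by (rule cSup_upper)
      then show "x \<in> {0..<Sup A}" using \<open>x < y\<close> x by (auto simp: A_def)
    next
      fix x assume x: "x \<in> {0..<Sup A}"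
      then obtain y where "y \<in> A" "x < y"
        using less_cSup_iff[OF False bdd] by auto
      then show "x \<in> A"
        using x distribution_fun_antimono[OF m \<Omega>, of x y] by (auto simp: A_def)
    qed
    moreover have "0 \<le> Sup A"
    proof -
      from False obtain \<beta> where "\<beta> \<in> A" by auto
      then show ?thesis using cSup_upper[OF \<open>\<beta> \<in> A\<close> bdd] by (simp add: A_def)
    qed
    ultimately have "decreasing_rearrangement \<Omega> f s = Sup A"
      unfolding decreasing_rearrangement_def A_def[symmetric]
      by (metis measure_completion measure_lborel_Ico diff_zero sets_lborel sets.sets_Collect atLeastLessThan_borel)
    moreover have "\<alpha> < Sup A \<longleftrightarrow> \<alpha> \<in> A"
      using \<open>A = {0..<Sup A}\<close> \<alpha> by (metis atLeastLessThan_iff)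
    ultimately show ?thesis
      using \<alpha> by (simp add: A_def)
  qed
qed

section \<open>Truncation at height k\<close>

lemma distribution_fun_truncate:
  assumes "0 \<le> \<alpha>"
  shows "distribution_fun \<Omega> (\<lambda>x. max (\<bar>f x\<bar> - k) 0) \<alpha> = distribution_fun \<Omega> f (\<alpha> + k)"
proof -
  have "{x \<in> \<Omega>. \<bar>max (\<bar>f x\<bar> - k) 0\<bar> > \<alpha>} = {x \<in> \<Omega>. \<bar>f x\<bar> > \<alpha> + k}"
    using assms by (auto simp: max_def)
  then show ?thesis by (simp add: distribution_fun_def)
qed

lemma rearrangeable_truncate:
  fixes f :: "'a::euclidean_space \<Rightarrow> real"
  assumes "rearrangeable \<Omega> f"
  shows "rearrangeable \<Omega> (\<lambda>x. max (\<bar>f x\<bar> - k) 0)"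
proof -
  have [measurable]: "f \<in> borel_measurable (lebesgue_on \<Omega>)"
    and lim: "(distribution_fun \<Omega> f \<longlongrightarrow> 0) at_top"
    using assms by (auto simp: rearrangeable_def)
  have "filterlim (\<lambda>\<alpha>. \<alpha> + k) at_top at_top"
    unfolding filterlim_at_top eventually_at_top_linorder
    by (metis diff_le_eq)
  then have "((\<lambda>\<alpha>. distribution_fun \<Omega> f (\<alpha> + k)) \<longlongrightarrow> 0) at_top"
    by (rule filterlim_compose[OF lim])
  moreover have "eventually (\<lambda>\<alpha>. distribution_fun \<Omega> f (\<alpha> + k)
      = distribution_fun \<Omega> (\<lambda>x. max (\<bar>f x\<bar> - k) 0) \<alpha>) at_top"
    using eventually_ge_at_top[of 0] by eventually_elim (simp add: distribution_fun_truncate)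
  ultimately have "(distribution_fun \<Omega> (\<lambda>x. max (\<bar>f x\<bar> - k) 0) \<longlongrightarrow> 0) at_top"
    by (rule Lim_transform_eventually)
  then show ?thesis
    by (simp add: rearrangeable_def)
qed

text \<open>Two nonnegative numbers agree if the same levels \<alpha> \<ge> 0 lie strictly below
  both. Truncation shifts levels by k, so both conditions become the same condition on f at level
  \<alpha> + k.\<close>

lemma decreasing_rearrangement_truncate:
  fixes f :: "'a::euclidean_space \<Rightarrow> real"
  assumes \<Omega>: "\<Omega> \<in> sets lebesgue" and f: "rearrangeable \<Omega> f" and s: "0 < s" and k: "0 \<le> k"
  shows "decreasing_rearrangement \<Omega> (\<lambda>x. max (\<bar>f x\<bar> - k) 0) s
    = max (decreasing_rearrangement \<Omega> f s - k) 0" (is "?u = ?v")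
proof -
  have "\<alpha> < ?u \<longleftrightarrow> \<alpha> < ?v" if "0 \<le> \<alpha>" for \<alpha>
  proof -
    have "\<alpha> < ?u \<longleftrightarrow> ennreal s < distribution_fun \<Omega> f (\<alpha> + k)"
      using less_decreasing_rearrangement_iff[OF \<Omega> rearrangeable_truncate[OF f] s that]
      unfolding distribution_fun_truncate[OF that] .
    also have "\<dots> \<longleftrightarrow> \<alpha> + k < decreasing_rearrangement \<Omega> f s"
      by (rule less_decreasing_rearrangement_iff[OF \<Omega> f s, symmetric]) (use k that in simp)
    also have "\<dots> \<longleftrightarrow> \<alpha> < ?v"
      using that by (simp add: less_max_iff_disj less_diff_eq)
    finally show ?thesis .
  qed
  moreover have "0 \<le> ?u" "0 \<le> ?v"
    by (auto simp: decreasing_rearrangement_nonneg)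
  ultimately show ?thesis
    by (metis less_irrefl linorder_neqE)
qed

section \<open>Tail integrals of f through the integral of its rearrangement\<close>

text \<open>A discrete layer-cake bound: the levels k, k + 1, ... lying below y number the ceiling
  of y - k when this is positive, and rounding up gives an upper bound for y - k.\<close>

lemma ennreal_truncate_le_suminf_indicator:
  fixes y k :: real
  shows "ennreal (max (y - k) 0) \<le> (\<Sum>i. indicator {k + real i<..} y)"
proof -
  define n where "n = nat \<lceil>y - k\<rceil>"
  have "y > k + real i" if "i < n" for i
    using that unfolding n_def by linarith
  then have "(\<Sum>i<n. indicator {k + real i<..} y) = (\<Sum>i<n. 1::ennreal)"
    by (intro sum.cong) (auto simp: indicator_def)
  then have "(\<Sum>i<n. indicator {k + real i<..} y) = ennreal (real n)"
    by (simp add: ennreal_of_nat_eq_real_of_nat)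
  moreover have "max (y - k) 0 \<le> real n"
    unfolding n_def by linarith
  ultimately have "ennreal (max (y - k) 0) \<le> (\<Sum>i<n. indicator {k + real i<..} y)"
    by (simp add: ennreal_leI)
  also have "\<dots> \<le> (\<Sum>i. indicator {k + real i<..} y)"
    by (intro sum_le_suminf) auto
  finally show ?thesis .
qed

text \<open>The companion count from the other side: starting one level higher, at k + 1, turns the
  rounding in the opposite direction.\<close>

lemma suminf_indicator_le_ennreal:
  fixes y k :: real
  assumes "0 \<le> y" "0 \<le> k"
  shows "(\<Sum>i. indicator {k + real (Suc i)<..} y) \<le> ennreal y"
proof (rule suminf_le_const)
  fix n
  \<comment> \<open>The bound by \<open>real n\<close> strengthens the induction: when the next
    indicator is 1, y exceeds n + 1, so a sum of at most n may grow by one and still stay below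
    y.\<close>
  have "(\<Sum>i<n. indicator {k + real (Suc i)<..} y :: real) \<le> min (real n) y"
    using assms by (induction n) (auto simp: indicator_def)
  then have "ennreal (\<Sum>i<n. indicator {k + real (Suc i)<..} y) \<le> ennreal y"
    by (intro ennreal_leI) simp
  then show "(\<Sum>i<n. indicator {k + real (Suc i)<..} y) \<le> ennreal y"
    by (simp add: ennreal_indicator sum_ennreal[symmetric])
qed simp

lemma nn_integral_truncate_le:
  fixes f :: "'a::euclidean_space \<Rightarrow> real"
  assumes f: "f \<in> borel_measurable (lebesgue_on \<Omega>)" "\<Omega> \<in> sets lebesgue"
  shows "(\<integral>\<^sup>+x\<in>\<Omega>. ennreal (max (\<bar>f x\<bar> - k) 0) \<partial>lebesgue)
    \<le> (\<Sum>i. distribution_fun \<Omega> f (k + real i))"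
proof -
  let ?A = "\<lambda>i. {x \<in> \<Omega>. \<bar>f x\<bar> > k + real i}"
  have A: "?A i \<in> sets lebesgue" for i by (rule sets_abs_greater[OF f])
  have "(\<integral>\<^sup>+x\<in>\<Omega>. ennreal (max (\<bar>f x\<bar> - k) 0) \<partial>lebesgue)
      \<le> (\<integral>\<^sup>+x. (\<Sum>i. indicator (?A i) x) \<partial>lebesgue)"
  proof (rule nn_integral_mono)
    fix x
    show "ennreal (max (\<bar>f x\<bar> - k) 0) * indicator \<Omega> x \<le> (\<Sum>i. indicator (?A i) x)"
      using ennreal_truncate_le_suminf_indicator[of "\<bar>f x\<bar>" k]
      by (cases "x \<in> \<Omega>") (simp_all add: indicator_def)
  qed
  also have "\<dots> = (\<Sum>i. \<integral>\<^sup>+x. indicator (?A i) x \<partial>lebesgue)"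
    using A by (intro nn_integral_suminf) simp
  also have "\<dots> = (\<Sum>i. distribution_fun \<Omega> f (k + real i))"
    using A by (simp add: distribution_fun_def)
  finally show ?thesis .
qed

text \<open>Each term is the length of an interval (0, r) on which the rearrangement exceeds the
  level in question, and a point t lies in at most F(t) of these intervals, F being the
  rearrangement. The bound at level k keeps all the intervals inside (0, s).\<close>

lemma suminf_distribution_fun_le:
  fixes f :: "'a::euclidean_space \<Rightarrow> real"
  assumes \<Omega>: "\<Omega> \<in> sets lebesgue" and f: "rearrangeable \<Omega> f" and "0 \<le> k"
    and s: "distribution_fun \<Omega> f k \<le> ennreal s" "0 < s"
  shows "(\<Sum>i. distribution_fun \<Omega> f (k + real (Suc i)))
    \<le> (\<integral>\<^sup>+t\<in>{0<..<s}. ennreal (decreasing_rearrangement \<Omega> f t) \<partial>lebesgue)"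
proof -
  let ?F = "decreasing_rearrangement \<Omega> f"
  define r where "r i = enn2real (distribution_fun \<Omega> f (k + real (Suc i)))" for i
  have m: "f \<in> borel_measurable (lebesgue_on \<Omega>)" using f by (simp add: rearrangeable_def)
  have le: "distribution_fun \<Omega> f (k + real (Suc i)) \<le> ennreal s" for i
    by (rule order_trans[OF distribution_fun_antimono[OF m \<Omega>] s(1)]) simp
  then have r: "distribution_fun \<Omega> f (k + real (Suc i)) = ennreal (r i)" for i
    unfolding r_def by (metis ennreal_enn2real ennreal_less_top order_le_less_trans)
  have r0: "0 \<le> r i" for i by (simp add: r_def)
  have rs: "r i \<le> s" for i using le[of i] r[of i] s by simp
  have F: "k + real (Suc i) < ?F t" if "t \<in> {0<..<r i}" for i t
    using less_decreasing_rearrangement_iff[OF \<Omega> f, of t "k + real (Suc i)"] that \<open>0 \<le> k\<close> r[of i]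
    by (simp add: ennreal_lessI)
  have "(\<Sum>i. distribution_fun \<Omega> f (k + real (Suc i)))
      = (\<Sum>i. \<integral>\<^sup>+t. indicator {0<..<r i} t \<partial>lebesgue)"
    using r0 by (intro suminf_cong) (simp add: r del: of_nat_Suc)
  also have "\<dots> = (\<integral>\<^sup>+t. (\<Sum>i. indicator {0<..<r i} t) \<partial>lebesgue)"
    by (intro nn_integral_suminf[symmetric] borel_measurable_indicator) simp
  also have "\<dots> \<le> (\<integral>\<^sup>+t\<in>{0<..<s}. ennreal (?F t) \<partial>lebesgue)"
  proof (rule nn_integral_mono)
    fix t :: real
    show "(\<Sum>i. indicator {0<..<r i} t) \<le> ennreal (?F t) * indicator {0<..<s} t"
    proof (cases "t \<in> {0<..<s}")
      case True
      have "(\<Sum>i. indicator {0<..<r i} t) \<le> (\<Sum>i. indicator {k + real (Suc i)<..} (?F t) :: ennreal)"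
        by (intro suminf_le) (use F in \<open>auto simp: indicator_def\<close>)
      also have "\<dots> \<le> ennreal (?F t)"
        using \<open>0 \<le> k\<close> by (intro suminf_indicator_le_ennreal decreasing_rearrangement_nonneg)
      finally show ?thesis using True by simp
    next
      case False
      then have "t \<notin> {0<..<r i}" for i using rs[of i] by auto
      then show ?thesis by simp
    qed
  qed
  finally show ?thesis .
qed

text \<open>Integrability of the rearrangement near 0 makes the series of distribution values at
  unit-spaced levels converge, and the tails of this series dominate the integrals of the
  truncations of f.\<close>

lemma nn_integral_truncate_small:
  fixes f :: "'a::euclidean_space \<Rightarrow> real"
  assumes \<Omega>: "\<Omega> \<in> sets lebesgue" and f: "rearrangeable \<Omega> f" and s: "0 < s"
    and int: "set_integrable lebesgue {0<..<s} (decreasing_rearrangement \<Omega> f)"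
    and \<epsilon>: "0 < \<epsilon>"
  shows "\<exists>k\<ge>0. (\<integral>\<^sup>+x\<in>\<Omega>. ennreal (max (\<bar>f x\<bar> - k) 0) \<partial>lebesgue) \<le> ennreal \<epsilon>"
proof -
  let ?F = "decreasing_rearrangement \<Omega> f"
  have m: "f \<in> borel_measurable (lebesgue_on \<Omega>)"
    and lim: "(distribution_fun \<Omega> f \<longlongrightarrow> 0) at_top"
    using f by (auto simp: rearrangeable_def)
  have "eventually (\<lambda>k. distribution_fun \<Omega> f k < ennreal s \<and> 0 \<le> k) at_top"
    using s by (intro eventually_conj order_tendstoD(2)[OF lim] eventually_ge_at_top) simp
  then obtain K where K: "distribution_fun \<Omega> f K < ennreal s" "0 \<le> K"
    by (auto simp: eventually_at_top_linorder)
  define a where "a i = distribution_fun \<Omega> f (K + real (Suc i))" for i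
  have "(\<integral>\<^sup>+t\<in>{0<..<s}. ennreal (?F t) \<partial>lebesgue)
      = (\<integral>\<^sup>+t. ennreal (norm (indicator {0<..<s} t *\<^sub>R ?F t)) \<partial>lebesgue)"
    by (intro nn_integral_cong) (auto simp: indicator_def decreasing_rearrangement_nonneg)
  also have "\<dots> < \<infinity>"
    using int unfolding set_integrable_def integrable_iff_bounded by simp
  finally have "(\<Sum>i. a i) < \<infinity>"
    unfolding a_def
    using suminf_distribution_fun_le[OF \<Omega> f K(2) less_imp_le[OF K(1)] s] by (rule le_less_trans[rotated])
  then have fin: "(\<Sum>i. a i) \<noteq> top" by simp
  moreover have "a i \<le> (\<Sum>i. a i)" for i
    using sum_le_suminf[of a "{i}"] by simp
  ultimately have a_top: "a i \<noteq> top" for i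
    by (metis neq_top_trans)
  have ea: "ennreal (enn2real (a i)) = a i" for i using a_top[of i] by (simp add: less_top)
  \<comment> \<open>The tail theorem for series is applied in the reals, so the finite extended
    values are converted first.\<close>
  have sm: "summable (\<lambda>i. enn2real (a i))"
    by (rule summable_suminf_not_top) (simp_all only: ea fin enn2real_nonneg not_False_eq_True)
  obtain N where N: "\<forall>n\<ge>N. norm (\<Sum>i. enn2real (a (i + n))) < \<epsilon>"
    using suminf_exist_split[OF \<epsilon> sm] by blast
  \<comment> \<open>With this k, the level k + i is exactly the one used in
    \<open>a (i + N)\<close>, so the layer-cake series is the tail of the series of \<open>a\<close>
    from index N.\<close>
  define k where "k = K + real (Suc N)"
  have "(\<integral>\<^sup>+x\<in>\<Omega>. ennreal (max (\<bar>f x\<bar> - k) 0) \<partial>lebesgue) \<le> (\<Sum>i. distribution_fun \<Omega> f (k + real i))"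
    by (rule nn_integral_truncate_le[OF m \<Omega>])
  also have "\<dots> = (\<Sum>i. a (i + N))"
    by (simp add: a_def k_def add_ac)
  also have "\<dots> = ennreal (\<Sum>i. enn2real (a (i + N)))"
    using summable_ignore_initial_segment[OF sm, of N]
    by (subst suminf_ennreal2[symmetric]) (auto simp: ea)
  also have "\<dots> \<le> ennreal \<epsilon>"
    using N[rule_format, of N] by (intro ennreal_leI) auto
  finally show ?thesis
    using K(2) by (intro exI[of _ k]) (simp add: k_def)
qed

section \<open>Small shapes and gaps in the range of |f|\<close>

lemma shape_basisD:
  assumes "shape_basis \<Omega> \<S>" "S \<in> \<S>"
  shows "S \<in> sets lebesgue" "S \<subseteq> \<Omega>" "emeasure lebesgue S < \<infinity>" "0 < measure lebesgue S"
  using assms unfolding shape_basis_def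
  by (auto simp: measure_def enn2real_positive_iff less_top)

lemma mean_osc_le_bmo_norm:
  assumes "S \<in> \<S>"
  shows "ennreal (mean_osc f S) \<le> bmo_norm \<S> f"
  unfolding bmo_norm_def by (rule SUP_upper[OF assms])

lemma VMO_small_shapes:
  assumes "f \<in> VMO \<S>" "0 < \<epsilon>"
  shows "\<exists>\<delta>>0. \<forall>S\<in>\<S>. measure lebesgue S \<le> \<delta> \<longrightarrow> mean_osc f S < \<epsilon>"
proof -
  have "((\<lambda>\<delta>::real. SUP S\<in>{S\<in>\<S>. measure lebesgue S \<le> \<delta>}. ennreal (mean_osc f S)) \<longlongrightarrow> 0) (at_right 0)"
    using assms by (simp add: VMO_def)
  then have "eventually (\<lambda>\<delta>. (SUP S\<in>{S\<in>\<S>. measure lebesgue S \<le> \<delta>}. ennreal (mean_osc f S)) < ennreal \<epsilon>) (at_right 0)"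
    using assms(2) by (intro order_tendstoD(2)) auto
  then obtain b where b: "b > 0"
    and lt: "\<And>\<delta>. 0 < \<delta> \<Longrightarrow> \<delta> < b \<Longrightarrow>
      (SUP S\<in>{S\<in>\<S>. measure lebesgue S \<le> \<delta>}. ennreal (mean_osc f S)) < ennreal \<epsilon>"
    by (auto simp: eventually_at_right_field)
  have "mean_osc f S < \<epsilon>" if "S \<in> \<S>" "measure lebesgue S \<le> b / 2" for S
  proof -
    have "ennreal (mean_osc f S) \<le> (SUP S\<in>{S\<in>\<S>. measure lebesgue S \<le> b / 2}. ennreal (mean_osc f S))"
      using that by (intro SUP_upper) auto
    also have "\<dots> < ennreal \<epsilon>" using b by (intro lt) auto
    finally show ?thesis by (simp add: ennreal_less_iff mean_osc_nonneg)
  qed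
  then show ?thesis using b by (intro exI[of _ "b / 2"]) auto
qed

text \<open>The number |mean f S| lies on one side of the midpoint of a and b, so on the opposite
  part, E or its complement in S, f stays at least (b - a)/2 away from its mean. That part has
  density \<rho> or 1 - \<rho>, and both are at least \<rho>(1 - \<rho>).\<close>

lemma density_in_gap_le_mean_osc:
  fixes f :: "'a::euclidean_space \<Rightarrow> real"
  assumes S: "S \<in> sets lebesgue" "emeasure lebesgue S < \<infinity>" "0 < measure lebesgue S"
    and f: "set_integrable lebesgue S f"
    and E: "E \<in> sets lebesgue" "\<And>x. x \<in> E \<inter> S \<Longrightarrow> b < \<bar>f x\<bar>"
    and gap: "AE x in lebesgue_on S. x \<notin> E \<longrightarrow> \<bar>f x\<bar> \<le> a" and ab: "a < b"
  shows "(b - a) / 2 * (density_in E S * (1 - density_in E S)) \<le> mean_osc f S"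
proof -
  let ?M = "lebesgue_on S" and ?m = "measure lebesgue S"
  interpret finite_measure ?M
    using S by (intro finite_measureI) (auto simp: emeasure_restrict_space)
  have i: "integrable ?M f"
    using f S by (simp add: set_integrable_eq)
  have ES: "E \<inter> S \<in> sets ?M" "S - E \<in> sets ?M"
    using E S by (auto simp: sets_restrict_space_iff)
  define \<rho> where "\<rho> = density_in E S"
  have mE: "measure ?M (E \<inter> S) = \<rho> * ?m"
    using S by (simp add: measure_restrict_space density_in_def \<rho>_def)
  have "measure ?M (S - E) = measure ?M S - measure ?M (E \<inter> S)"
    using finite_measure_Diff[of S "E \<inter> S"] ES S
    by (simp add: Diff_Int)
  then have mD: "measure ?M (S - E) = (1 - \<rho>) * ?m"
    using S mE by (simp add: measure_restrict_space algebra_simps)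
  have "0 \<le> \<rho>" by (simp add: \<rho>_def density_in_def)
  have "0 \<le> 1 - \<rho>" using mD S by (metis measure_nonneg zero_le_mult_iff not_less)
  define c where "c = \<bar>mean f S\<bar>"
  have osc: "mean_osc f S = (1 / ?m) * (LINT x|?M. \<bar>f x - mean f S\<bar>)"
    using S by (simp add: mean_osc_def set_lebesgue_integral_eq_lebesgue_on)
  \<comment> \<open>The reverse triangle inequality transfers the gap from |f| to f itself.\<close>
  have c: "\<bar>\<bar>f x\<bar> - c\<bar> \<le> \<bar>f x - mean f S\<bar>" for x
    unfolding c_def by linarith
  \<comment> \<open>A Chebyshev-type bound, stated once for both cases: A occupies the fraction
    \<sigma> of S, and the deviation from the mean is at least (b - a)/2 on it.\<close>
  have *: "(b - a) / 2 * \<sigma> \<le> mean_osc f S"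
    if A: "A \<in> sets ?M" "measure ?M A = \<sigma> * ?m"
      and AE: "AE x in ?M. (b - a) / 2 * indicator A x \<le> \<bar>f x - mean f S\<bar>" for A \<sigma>
  proof -
    have "integrable ?M (indicator A :: _ \<Rightarrow> real)"
      using A(1) by (intro integrable_real_indicator) (auto simp: less_top[symmetric])
    then have iA: "integrable ?M (\<lambda>x. (b - a) / 2 * indicator A x)"
      by (rule integrable_mult_right)
    have "(b - a) / 2 * (\<sigma> * ?m) = (LINT x|?M. (b - a) / 2 * indicator A x)"
      using A sets.sets_into_space[OF A(1)] by (simp add: Int_absorb2)
    also have "\<dots> \<le> (LINT x|?M. \<bar>f x - mean f S\<bar>)"
      by (rule integral_mono_AE[OF iA _ AE]) (use i in simp)
    finally show ?thesis unfolding osc using S by (simp add: field_simps)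
  qed
  show ?thesis
  proof (cases "c \<le> (a + b) / 2")
    case True
    have "(b - a) / 2 * indicator (E \<inter> S) x \<le> \<bar>f x - mean f S\<bar>" for x
    proof (cases "x \<in> E \<inter> S")
      case True
      then show ?thesis using E(2)[of x] c[of x] \<open>c \<le> (a + b) / 2\<close> by simp argo
    qed simp
    then have "(b - a) / 2 * \<rho> \<le> mean_osc f S"
      by (intro *[OF ES(1) mE]) auto
    moreover have "(b - a) / 2 * (\<rho> * (1 - \<rho>)) \<le> (b - a) / 2 * \<rho>"
      using \<open>0 \<le> \<rho>\<close> ab by (intro mult_left_mono) (auto intro: mult_left_le)
    ultimately show ?thesis by (simp add: \<rho>_def)
  next
    case False
    have "AE x in ?M. (b - a) / 2 * indicator (S - E) x \<le> \<bar>f x - mean f S\<bar>"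
      using gap
    proof (eventually_elim)
      case (elim x)
      show ?case
      proof (cases "x \<in> S - E")
        case True
        then show ?thesis using elim c[of x] False by simp argo
      qed simp
    qed
    then have "(b - a) / 2 * (1 - \<rho>) \<le> mean_osc f S"
      by (intro *[OF ES(2) mD])
    moreover have "\<rho> * (1 - \<rho>) \<le> 1 * (1 - \<rho>)"
      using \<open>0 \<le> 1 - \<rho>\<close> by (intro mult_right_mono) auto
    then have "(b - a) / 2 * (\<rho> * (1 - \<rho>)) \<le> (b - a) / 2 * (1 - \<rho>)"
      using ab by (intro mult_left_mono) auto
    ultimately show ?thesis by (simp add: \<rho>_def)
  qed
qed

text \<open>If the slab were null, |f| would jump from at most a to above b. The density condition
  for the set where |f| > b then gives arbitrarily small shapes with \<rho>(1 - \<rho>) > q/2, on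
  which f oscillates by a fixed amount, against vanishing mean oscillation.\<close>

lemma VMO_no_gap:
  fixes f :: "'a::euclidean_space \<Rightarrow> real"
  assumes \<Omega>: "\<Omega> \<in> sets lebesgue" and m: "f \<in> borel_measurable (lebesgue_on \<Omega>)"
    and \<S>: "shape_basis \<Omega> \<S>" and dens: "density_condition \<Omega> \<S>" and f: "f \<in> VMO \<S>"
    and ab: "a < b" and gt: "0 < emeasure lebesgue {x\<in>\<Omega>. b < \<bar>f x\<bar>}"
    and le: "0 < emeasure lebesgue {x\<in>\<Omega>. \<bar>f x\<bar> \<le> a}"
  shows "0 < emeasure lebesgue {x\<in>\<Omega>. a < \<bar>f x\<bar> \<and> \<bar>f x\<bar> \<le> b}"
proof (rule ccontr)
  let ?E = "{x\<in>\<Omega>. b < \<bar>f x\<bar>}" and ?G = "{x\<in>\<Omega>. a < \<bar>f x\<bar> \<and> \<bar>f x\<bar> \<le> b}"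
  assume "\<not> ?thesis"
  moreover have G: "?G \<in> sets lebesgue"
    by (rule sets_lebesgue_Collect_on[OF m \<Omega>]) measurable
  ultimately have null: "?G \<in> null_sets lebesgue"
    by (auto simp: null_sets_def not_gr_zero)
  have E: "?E \<in> sets lebesgue" by (rule sets_abs_greater[OF m \<Omega>])
  have "emeasure lebesgue {x\<in>\<Omega>. \<bar>f x\<bar> \<le> a} \<le> emeasure lebesgue (\<Omega> - ?E)"
    using ab \<Omega> E by (intro emeasure_mono) auto
  with le have "0 < emeasure lebesgue (\<Omega> - ?E)" by (rule less_le_trans)
  obtain q :: real where q: "0 < q"
    and lim: "ereal q \<le> Limsup (small_shapes \<S>) (\<lambda>S. ereal (density_in ?E S * (1 - density_in ?E S)))"
  proof -
    from dens obtain q :: real where "0 < q"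
      and *: "\<And>E. E \<in> sets lebesgue \<and> E \<subseteq> \<Omega> \<and> 0 < emeasure lebesgue E \<and> 0 < emeasure lebesgue (\<Omega> - E) \<longrightarrow>
        ereal q \<le> Limsup (small_shapes \<S>) (\<lambda>S. ereal (density_in E S * (1 - density_in E S)))"
      unfolding density_condition_def by blast
    with *[of ?E] gt E \<open>0 < emeasure lebesgue (\<Omega> - ?E)\<close> that show ?thesis by blast
  qed
  \<comment> \<open>The threshold is the gap bound at \<rho>(1 - \<rho>) = q/2, so every small shape
    has a value strictly below q/2 and the limsup cannot reach q.\<close>
  obtain \<delta> where \<delta>: "\<delta> > 0"
    "\<And>S. S \<in> \<S> \<Longrightarrow> measure lebesgue S \<le> \<delta> \<Longrightarrow> mean_osc f S < (b - a) / 2 * (q / 2)"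
    using VMO_small_shapes[OF f, of "(b - a) / 2 * (q / 2)"] ab q by auto
  have "eventually (\<lambda>r. r < \<delta>) (at_right (0::real))"
    using \<delta>(1) by (auto simp: eventually_at_right_field)
  then have ev: "eventually (\<lambda>S. S \<in> \<S> \<and> measure lebesgue S < \<delta>) (small_shapes \<S>)"
    unfolding small_shapes_def eventually_inf_principal
    by (rule eventually_mono[OF eventually_filtercomapI]) auto
  have "ereal (density_in ?E S * (1 - density_in ?E S)) \<le> ereal (q / 2)"
    if S: "S \<in> \<S>" "measure lebesgue S < \<delta>" for S
  proof -
    note SS = shape_basisD[OF \<S> S(1)]
    have "(b - a) / 2 * (density_in ?E S * (1 - density_in ?E S)) \<le> mean_osc f S"
    proof (rule density_in_gap_le_mean_osc[OF SS(1,3,4) _ E _ _ ab])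
      show "set_integrable lebesgue S f" using f S by (auto simp: VMO_def BMO_def)
      show "AE x in lebesgue_on S. x \<notin> ?E \<longrightarrow> \<bar>f x\<bar> \<le> a"
        using SS AE_not_in[OF null] by (subst AE_restrict_space_iff) (auto elim!: eventually_mono)
    qed auto
    also have "\<dots> < (b - a) / 2 * (q / 2)" using \<delta>(2)[OF S(1)] S(2) by simp
    finally show ?thesis using ab by (simp add: mult_less_cancel_left)
  qed
  with ev have "Limsup (small_shapes \<S>) (\<lambda>S. ereal (density_in ?E S * (1 - density_in ?E S))) \<le> ereal (q / 2)"
    by (intro Limsup_bounded) (auto elim: eventually_mono)
  with lim have "ereal q \<le> ereal (q / 2)" by (rule order_trans)
  with q show False by simp
qed

section \<open>Uniform continuity of the rearrangement cut off at k\<close>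

text \<open>Heights are cut into slabs of thickness \<epsilon>; \<delta> is taken below the measure
  of every nonnull slab among the finitely many below k. A drop by more than 2 \<epsilon> between s
  and t must cross one complete slab, which is nonnull by \<open>gap\<close> and has room only if t
  - s > \<delta>.\<close>

lemma decreasing_rearrangement_equicontinuous:
  fixes f :: "'a::euclidean_space \<Rightarrow> real"
  assumes \<Omega>: "\<Omega> \<in> sets lebesgue" and r: "rearrangeable \<Omega> f"
    and gap: "\<And>a b. a < b \<Longrightarrow> 0 < emeasure lebesgue {x\<in>\<Omega>. b < \<bar>f x\<bar>} \<Longrightarrow>
      0 < emeasure lebesgue {x\<in>\<Omega>. \<bar>f x\<bar> \<le> a} \<Longrightarrow>
      0 < emeasure lebesgue {x\<in>\<Omega>. a < \<bar>f x\<bar> \<and> \<bar>f x\<bar> \<le> b}"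
    and \<epsilon>: "0 < \<epsilon>"
  shows "\<exists>\<delta>>0. \<forall>s\<in>measure_interval \<Omega>. \<forall>t\<in>measure_interval \<Omega>. \<bar>t - s\<bar> \<le> \<delta> \<longrightarrow>
    \<bar>min (decreasing_rearrangement \<Omega> f s) k - min (decreasing_rearrangement \<Omega> f t) k\<bar> \<le> 2 * \<epsilon>"
proof -
  let ?F = "decreasing_rearrangement \<Omega> f" and ?\<mu> = "distribution_fun \<Omega> f"
  have m: "f \<in> borel_measurable (lebesgue_on \<Omega>)"
    using r by (simp add: rearrangeable_def)
  define G where "G i = {x\<in>\<Omega>. real i * \<epsilon> < \<bar>f x\<bar> \<and> \<bar>f x\<bar> \<le> real (Suc i) * \<epsilon>}" for i
  have G: "G i \<in> sets lebesgue" for i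
    unfolding G_def by (rule sets_lebesgue_Collect_on[OF m \<Omega>]) measurable
  define N where "N = nat \<lceil>k / \<epsilon>\<rceil>"
  \<comment> \<open>Working with small d replaces a minimum over the nonnull slabs, whose measures
    may be infinite; null slabs impose no condition.\<close>
  have "eventually (\<lambda>d. 0 < emeasure lebesgue (G i) \<longrightarrow> ennreal d < emeasure lebesgue (G i)) (at_right 0)" for i
  proof (cases "0 < emeasure lebesgue (G i)")
    case True
    have "((\<lambda>d. ennreal d) \<longlongrightarrow> ennreal 0) (at_right 0)"
      by (intro tendsto_ennrealI tendsto_ident_at)
    then have "eventually (\<lambda>d. ennreal d < emeasure lebesgue (G i)) (at_right 0)"
      using True by (intro order_tendstoD(2)) auto
    then show ?thesis by eventually_elim simp
  qed simp
  then have "eventually (\<lambda>d. \<forall>i\<in>{..<N}. 0 < emeasure lebesgue (G i) \<longrightarrow> ennreal d < emeasure lebesgue (G i)) (at_right 0)"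
    by (intro eventually_ball_finite) auto
  moreover have "eventually (\<lambda>d. 0 < d) (at_right (0::real))"
    by (rule eventually_at_right_less)
  ultimately have "eventually (\<lambda>d. 0 < d \<and> (\<forall>i\<in>{..<N}. 0 < emeasure lebesgue (G i) \<longrightarrow> ennreal d < emeasure lebesgue (G i))) (at_right 0)"
    by eventually_elim simp
  then obtain \<delta> where \<delta>: "0 < \<delta>" "\<And>i. i < N \<Longrightarrow> 0 < emeasure lebesgue (G i) \<Longrightarrow> ennreal \<delta> < emeasure lebesgue (G i)"
    using eventually_happens'[OF trivial_limit_at_right_real] by blast
  have one: "min (?F s) k - min (?F t) k \<le> 2 * \<epsilon>"
    if s: "s \<in> measure_interval \<Omega>" and t: "t \<in> measure_interval \<Omega>" and st: "t - s \<le> \<delta>" for s t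
  proof (rule ccontr)
    assume neg: "\<not> ?thesis"
    have pos: "0 < s" "0 < t" "ennreal t < emeasure lebesgue \<Omega>"
      using s t by (auto simp: measure_interval_def)
    have F0: "0 \<le> ?F s" "0 \<le> ?F t" by (auto simp: decreasing_rearrangement_nonneg)
    \<comment> \<open>Otherwise the cut-off value at t would be k, leaving no drop from s.\<close>
    have Ft: "?F t < k" using neg \<epsilon> by linarith
    \<comment> \<open>This is the first grid index strictly above F(t). Reaching it costs at most
      \<epsilon> and crossing the slab above it another \<epsilon>, which is why the drop is
      measured against 2 \<epsilon>.\<close>
    define i where "i = nat \<lfloor>?F t / \<epsilon>\<rfloor> + 1"
    have "0 \<le> ?F t / \<epsilon>" using F0 \<epsilon> by simp
    then have i: "?F t / \<epsilon> < real i" "real i \<le> ?F t / \<epsilon> + 1"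
      unfolding i_def by linarith+
    then have i1: "?F t < real i * \<epsilon>" and i2: "real i * \<epsilon> \<le> ?F t + \<epsilon>"
      using \<epsilon> by (simp_all add: field_simps)
    have i3: "real (Suc i) * \<epsilon> < min (?F s) k"
    proof -
      have "real (Suc i) * \<epsilon> = real i * \<epsilon> + \<epsilon>" by (simp add: algebra_simps)
      then show ?thesis using i2 neg Ft by linarith
    qed
    then have "real (Suc i) < k / \<epsilon>" using \<epsilon> by (simp add: field_simps)
    then have "i < N" unfolding N_def by linarith
    have a: "ennreal s < ?\<mu> (real (Suc i) * \<epsilon>)"
      using i3 less_decreasing_rearrangement_iff[OF \<Omega> r pos(1), of "real (Suc i) * \<epsilon>"] \<epsilon>
      by (simp del: of_nat_Suc)
    have b: "?\<mu> (real i * \<epsilon>) \<le> ennreal t"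
    proof -
      have "0 \<le> real i * \<epsilon>" using \<epsilon> by simp
      then show ?thesis
        using i1 less_decreasing_rearrangement_iff[OF \<Omega> r pos(2)] by (meson not_less less_asym)
    qed
    \<comment> \<open>If this set were null, all of |\<Omega>| would be at most t, contradicting
      that t lies in the open interval (0, |\<Omega>|).\<close>
    have low: "0 < emeasure lebesgue {x\<in>\<Omega>. \<bar>f x\<bar> \<le> real i * \<epsilon>}"
    proof (rule ccontr)
      assume "\<not> ?thesis"
      then have "emeasure lebesgue {x\<in>\<Omega>. \<bar>f x\<bar> \<le> real i * \<epsilon>} = 0" by (simp add: not_gr_zero)
      moreover have L: "{x\<in>\<Omega>. \<bar>f x\<bar> \<le> real i * \<epsilon>} \<in> sets lebesgue"
        by (rule sets_lebesgue_Collect_on[OF m \<Omega>]) measurable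
      moreover have "\<Omega> = {x\<in>\<Omega>. \<bar>f x\<bar> > real i * \<epsilon>} \<union> {x\<in>\<Omega>. \<bar>f x\<bar> \<le> real i * \<epsilon>}" by auto
      ultimately have "emeasure lebesgue \<Omega> \<le> ?\<mu> (real i * \<epsilon>)"
        using emeasure_subadditive[OF sets_abs_greater[OF m \<Omega>, of "real i * \<epsilon>"] L]
        by (simp add: distribution_fun_def)
      with b pos(3) show False by (meson leD order_trans)
    qed
    have "0 < emeasure lebesgue (G i)"
      unfolding G_def
    proof (rule gap[OF _ _ low])
      show "real i * \<epsilon> < real (Suc i) * \<epsilon>" using \<epsilon> by simp
      show "0 < emeasure lebesgue {x\<in>\<Omega>. real (Suc i) * \<epsilon> < \<bar>f x\<bar>}"
        using a unfolding distribution_fun_def by (rule le_less_trans[rotated]) simp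
    qed
    then have Gi: "ennreal \<delta> < emeasure lebesgue (G i)" by (rule \<delta>(2)[OF \<open>i < N\<close>])
    \<comment> \<open>The upper superlevel set has measure above s, the slab above \<delta>, and
      their disjoint union at most t; hence s + \<delta> < t.\<close>
    have "{x\<in>\<Omega>. \<bar>f x\<bar> > real i * \<epsilon>} = {x\<in>\<Omega>. \<bar>f x\<bar> > real (Suc i) * \<epsilon>} \<union> G i"
    proof -
      have "real i * \<epsilon> \<le> real (Suc i) * \<epsilon>" using \<epsilon> by simp
      then show ?thesis unfolding G_def by auto
    qed
    then have "?\<mu> (real i * \<epsilon>) = emeasure lebesgue ({x\<in>\<Omega>. \<bar>f x\<bar> > real (Suc i) * \<epsilon>} \<union> G i)"
      unfolding distribution_fun_def by (rule arg_cong)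
    also have "\<dots> = ?\<mu> (real (Suc i) * \<epsilon>) + emeasure lebesgue (G i)"
      unfolding distribution_fun_def
      by (intro plus_emeasure[symmetric] sets_abs_greater[OF m \<Omega>] G) (auto simp: G_def)
    finally have "ennreal s + ennreal \<delta> < ?\<mu> (real i * \<epsilon>)"
      using add_strict_mono[OF a Gi] by simp
    also note b
    finally have "ennreal (s + \<delta>) < ennreal t"
      using pos \<delta>(1) by simp
    then have "s + \<delta> < t"
      using pos \<delta>(1) by (subst (asm) ennreal_less_iff) auto
    then show False using st by simp
  qed
  show ?thesis
  proof (intro exI[of _ \<delta>] conjI ballI impI)
    fix s t assume "s \<in> measure_interval \<Omega>" "t \<in> measure_interval \<Omega>" "\<bar>t - s\<bar> \<le> \<delta>"
    then show "\<bar>min (?F s) k - min (?F t) k\<bar> \<le> 2 * \<epsilon>"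
      using one[of s t] one[of t s] by (auto simp: abs_le_iff)
  qed (rule \<delta>(1))
qed

section \<open>Smallness of the unbounded part in BMO\<close>

lemma truncate_1_lipschitz: "\<bar>max (\<bar>x\<bar> - k) 0 - max (\<bar>y\<bar> - k) 0\<bar> \<le> \<bar>x - y\<bar>" for x y k :: real
  by (simp add: max_def abs_if)

lemma truncate_in_BMO:
  fixes f :: "'a::euclidean_space \<Rightarrow> real"
  assumes \<S>: "shape_basis \<Omega> \<S>" and f: "f \<in> BMO \<S>"
  shows "(\<lambda>x. max (\<bar>f x\<bar> - k) 0) \<in> BMO \<S>"
proof -
  let ?g = "\<lambda>x. max (\<bar>f x\<bar> - k) 0"
  have i: "set_integrable lebesgue S f" if "S \<in> \<S>" for S using f that by (auto simp: BMO_def)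
  have fin: "bmo_norm \<S> f < \<infinity>" using f by (auto simp: BMO_def)
  have "bmo_norm \<S> ?g \<le> 2 * bmo_norm \<S> f"
    unfolding bmo_norm_def[of _ ?g]
  proof (rule SUP_least)
    fix S assume S: "S \<in> \<S>"
    note D = shape_basisD[OF \<S> S]
    have "ennreal (mean_osc ?g S) \<le> ennreal (2 * mean_osc f S)"
      by (intro ennreal_leI mean_osc_1_lipschitz_comp[OF D(1,3,4) i[OF S] truncate_1_lipschitz])
    also have "\<dots> = 2 * ennreal (mean_osc f S)"
      by (simp add: ennreal_mult')
    also have "\<dots> \<le> 2 * bmo_norm \<S> f"
      by (intro mult_left_mono mean_osc_le_bmo_norm S) simp
    finally show "ennreal (mean_osc ?g S) \<le> 2 * bmo_norm \<S> f" .
  qed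
  also have "\<dots> < \<infinity>" using fin by (simp add: ennreal_mult_less_top)
  finally show ?thesis
    using set_integrable_1_lipschitz_comp[OF shape_basisD(1,3)[OF \<S>] i truncate_1_lipschitz]
    by (auto simp: BMO_def)
qed

text \<open>On small shapes vanishing mean oscillation bounds all truncations simultaneously, so
  \<delta> can be fixed before k. On shapes larger than \<delta> the oscillation is at most
  2/\<delta> times the integral over \<Omega>, which k then makes small.\<close>

lemma bmo_norm_truncate_small:
  fixes f :: "'a::euclidean_space \<Rightarrow> real"
  assumes \<S>: "shape_basis \<Omega> \<S>" and f: "f \<in> VMO \<S>" and \<eta>: "0 < \<eta>"
    and tail: "\<And>\<epsilon>. 0 < \<epsilon> \<Longrightarrow>
      \<exists>k\<ge>0. (\<integral>\<^sup>+x\<in>\<Omega>. ennreal (max (\<bar>f x\<bar> - k) 0) \<partial>lebesgue) \<le> ennreal \<epsilon>"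
  shows "\<exists>k\<ge>0. bmo_norm \<S> (\<lambda>x. max (\<bar>f x\<bar> - k) 0) \<le> ennreal \<eta>"
proof -
  obtain \<delta> where \<delta>: "\<delta> > 0"
    "\<And>S. S \<in> \<S> \<Longrightarrow> measure lebesgue S \<le> \<delta> \<Longrightarrow> mean_osc f S < \<eta> / 2"
    using VMO_small_shapes[OF f, of "\<eta> / 2"] \<eta> by auto
  \<comment> \<open>The bound \<eta> \<delta> / 2 cancels the factor 2/\<delta> from the large
    shapes and leaves \<eta>.\<close>
  obtain k where k: "0 \<le> k"
    and tl: "(\<integral>\<^sup>+x\<in>\<Omega>. ennreal (max (\<bar>f x\<bar> - k) 0) \<partial>lebesgue) \<le> ennreal (\<eta> * \<delta> / 2)"
    using tail[of "\<eta> * \<delta> / 2"] \<eta> \<delta>(1) by auto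
  let ?g = "\<lambda>x. max (\<bar>f x\<bar> - k) 0"
  have "mean_osc ?g S \<le> \<eta>" if S: "S \<in> \<S>" for S
  proof -
    note D = shape_basisD[OF \<S> S]
    have i: "set_integrable lebesgue S f" using f S by (auto simp: VMO_def BMO_def)
    note ig = set_integrable_1_lipschitz_comp[OF D(1,3) i truncate_1_lipschitz[where k=k]]
    show ?thesis
    proof (cases "measure lebesgue S \<le> \<delta>")
      case True
      have "mean_osc ?g S \<le> 2 * mean_osc f S"
        by (rule mean_osc_1_lipschitz_comp[OF D(1,3,4) i truncate_1_lipschitz])
      with \<delta>(2)[OF S True] show ?thesis by simp
    next
      case False
      have "ennreal (LINT x:S|lebesgue. ?g x) = (\<integral>\<^sup>+x\<in>S. ennreal (?g x) \<partial>lebesgue)"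
        using ig unfolding set_integrable_def set_lebesgue_integral_def
        by (subst nn_integral_eq_integral[symmetric])
           (auto intro!: nn_integral_cong simp: indicator_def)
      also have "\<dots> \<le> (\<integral>\<^sup>+x\<in>\<Omega>. ennreal (?g x) \<partial>lebesgue)"
        using D(2) by (intro nn_integral_mono) (auto simp: indicator_def)
      also note tl
      finally have I: "(LINT x:S|lebesgue. ?g x) \<le> \<eta> * \<delta> / 2"
        using \<eta> \<delta>(1) by (simp add: ennreal_le_iff)
      \<comment> \<open>The truncation is nonnegative, so comparing it with the constant 0 leaves
        its plain average.\<close>
      have "mean_osc ?g S \<le> 2 * ((1 / measure lebesgue S) * (LINT x:S|lebesgue. ?g x))"
        using mean_osc_le_twice[OF D(1,3,4) ig, of 0] by simp
      also have "\<dots> \<le> 2 * ((1 / measure lebesgue S) * (\<eta> * \<delta> / 2))"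
        using I by (intro mult_left_mono) auto
      also have "\<dots> = \<eta> * (\<delta> / measure lebesgue S)" by simp
      also have "\<dots> \<le> \<eta> * 1"
        using False D(4) \<eta> by (intro mult_left_mono) auto
      finally show ?thesis by simp
    qed
  qed
  then have "bmo_norm \<S> ?g \<le> ennreal \<eta>"
    unfolding bmo_norm_def by (intro SUP_least ennreal_leI)
  with k show ?thesis by auto
qed

section \<open>Combining the two summands on short intervals\<close>

theorem theorem4p1:
  fixes \<Omega> :: "(real ^ 'n) set" and \<S> :: "(real ^ 'n) set set"
  assumes "open \<Omega>" and "connected \<Omega>" and "\<Omega> \<noteq> {}"
    and "shape_basis \<Omega> \<S>"
    and "density_condition \<Omega> \<S>"
    and "\<exists>c::real. \<forall>f. f \<in> BMO \<S> \<and> rearrangeable \<Omega> f \<longrightarrow>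
           decreasing_rearrangement \<Omega> f \<in> BMO (intervals_in (measure_interval \<Omega>)) \<and>
           bmo_norm (intervals_in (measure_interval \<Omega>)) (decreasing_rearrangement \<Omega> f)
             \<le> ennreal c * bmo_norm \<S> f"
  shows "\<forall>f. f \<in> VMO \<S> \<and> rearrangeable \<Omega> f \<longrightarrow>
           decreasing_rearrangement \<Omega> f \<in> VMO (intervals_in (measure_interval \<Omega>))"
proof (intro allI impI)
  fix f assume "f \<in> VMO \<S> \<and> rearrangeable \<Omega> f"
  then have f: "f \<in> VMO \<S>" and r: "rearrangeable \<Omega> f" by auto
  let ?I = "measure_interval \<Omega>" and ?F = "decreasing_rearrangement \<Omega> f"
  let ?g = "\<lambda>k x. max (\<bar>f x\<bar> - k) 0"
  note \<S> = \<open>shape_basis \<Omega> \<S>\<close>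
  have \<Omega>: "\<Omega> \<in> sets lebesgue" using \<open>open \<Omega>\<close> by simp
  have m: "f \<in> borel_measurable (lebesgue_on \<Omega>)" using r by (simp add: rearrangeable_def)
  have fB: "f \<in> BMO \<S>" using f by (simp add: VMO_def)
  from assms(6) obtain c :: real where
    c: "\<And>f. f \<in> BMO \<S> \<Longrightarrow> rearrangeable \<Omega> f \<Longrightarrow>
           decreasing_rearrangement \<Omega> f \<in> BMO (intervals_in ?I) \<and>
           bmo_norm (intervals_in ?I) (decreasing_rearrangement \<Omega> f) \<le> ennreal c * bmo_norm \<S> f"
    by blast
  have FB: "?F \<in> BMO (intervals_in ?I)" using c[OF fB r] by simp
  obtain s where s: "0 < s" "ennreal s < emeasure lebesgue \<Omega>"
  proof -
    obtain S where "S \<in> \<S>" "S \<subseteq> \<Omega>" "0 < emeasure lebesgue S"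
      using \<S> \<open>\<Omega> \<noteq> {}\<close> unfolding shape_basis_def by blast
    then have "0 < emeasure lebesgue \<Omega>"
      using emeasure_mono[OF _ \<Omega>] by (metis order_less_le_trans)
    then obtain z where "0 < z" "z < emeasure lebesgue \<Omega>" using dense by blast
    then show thesis using that[of "enn2real z"]
      by (metis enn2real_positive_iff ennreal_enn2real ennreal_less_top less_trans top.not_eq_extremum order_less_le_trans top_greatest)
  qed
  \<comment> \<open>An admissible interval may touch 0, so membership of F in BMO includes
    integrability up to the end where F may blow up.\<close>
  have "{0<..<s} \<in> intervals_in ?I"
  proof -
    have "{0<..<s} \<subseteq> ?I"
      using s(2) by (auto simp: measure_interval_def intro: less_trans[OF ennreal_lessI[OF s(1)]])
    then show ?thesis using s(1) by (auto simp: intervals_in_def)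
  qed
  then have "set_integrable lebesgue {0<..<s} ?F" using FB by (auto simp: BMO_def)
  then have tail: "\<exists>k\<ge>0. (\<integral>\<^sup>+x\<in>\<Omega>. ennreal (?g k x) \<partial>lebesgue) \<le> ennreal \<epsilon>" if "0 < \<epsilon>" for \<epsilon>
    using that by (rule nn_integral_truncate_small[OF \<Omega> r s(1)])
  have key: "\<exists>\<delta>>0. \<forall>J\<in>intervals_in ?I. measure lebesgue J \<le> \<delta> \<longrightarrow> mean_osc ?F J \<le> \<epsilon>"
    if \<epsilon>: "0 < \<epsilon>" for \<epsilon> :: real
  proof -
    \<comment> \<open>The given c may be zero or negative; C is a positive replacement by which one
      can divide. With \<eta> = \<epsilon>/(4 C) the rearranged truncation has BMO norm at most
      \<epsilon>/4.\<close>
    define C where "C = max c 0 + 1"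
    have C: "0 < C" "max c 0 \<le> C" by (auto simp: C_def)
    define \<eta> where "\<eta> = \<epsilon> / (4 * C)"
    have \<eta>: "0 < \<eta>" using \<epsilon> C by (auto simp: \<eta>_def)
    obtain k where k: "0 \<le> k" and kn: "bmo_norm \<S> (?g k) \<le> ennreal \<eta>"
      using bmo_norm_truncate_small[OF \<S> f \<eta> tail] by blast
    let ?G = "decreasing_rearrangement \<Omega> (?g k)"
    have G: "?G \<in> BMO (intervals_in ?I)"
      and Gn: "bmo_norm (intervals_in ?I) ?G \<le> ennreal c * bmo_norm \<S> (?g k)"
      using c[OF truncate_in_BMO[OF \<S> fB] rearrangeable_truncate[OF r]] by auto
    note Gn
    also have "ennreal c * bmo_norm \<S> (?g k) \<le> ennreal (max c 0) * ennreal \<eta>"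
      by (intro mult_mono kn ennreal_leI) auto
    also have "\<dots> = ennreal (max c 0 * \<eta>)" using \<eta> by (simp add: ennreal_mult)
    also have "\<dots> \<le> ennreal (\<epsilon> / 4)"
    proof (rule ennreal_leI)
      have "max c 0 * \<eta> \<le> C * \<eta>" using \<eta> C by (intro mult_right_mono) auto
      also have "\<dots> = \<epsilon> / 4" using C by (simp add: \<eta>_def)
      finally show "max c 0 * \<eta> \<le> \<epsilon> / 4" .
    qed
    finally have Gn: "bmo_norm (intervals_in ?I) ?G \<le> ennreal (\<epsilon> / 4)" .
    \<comment> \<open>The bounded summand is allowed to vary by \<epsilon>/4. Each summand then
      contributes an average deviation of at most \<epsilon>/4, and \<open>mean_osc_le_twice\<close>
      doubles the total to \<epsilon>.\<close>
    obtain \<delta> where \<delta>: "0 < \<delta>" and eq: "\<And>s t. s \<in> ?I \<Longrightarrow> t \<in> ?I \<Longrightarrow> \<bar>t - s\<bar> \<le> \<delta> \<Longrightarrow>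
        \<bar>min (?F s) k - min (?F t) k\<bar> \<le> 2 * (\<epsilon> / 8)"
      using decreasing_rearrangement_equicontinuous[OF \<Omega> r
          VMO_no_gap[OF \<Omega> m \<S> \<open>density_condition \<Omega> \<S>\<close> f], of "\<epsilon> / 8" k] \<epsilon> by auto
    have "mean_osc ?F J \<le> \<epsilon>" if J: "J \<in> intervals_in ?I" "measure lebesgue J \<le> \<delta>" for J
    proof -
      obtain a b where ab: "a < b" "J = {a<..<b}" "J \<subseteq> ?I"
        using J by (auto simp: intervals_in_def)
      have Jm: "measure lebesgue J = b - a" using ab by simp
      have JD: "J \<in> sets lebesgue" "emeasure lebesgue J < \<infinity>" "0 < measure lebesgue J"
        using ab by auto
      interpret finite_measure "lebesgue_on J"
        using JD by (intro finite_measureI) (auto simp: emeasure_restrict_space)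
      have iF: "set_integrable lebesgue J ?F" using FB J by (auto simp: BMO_def)
      have iG: "set_integrable lebesgue J ?G" using G J by (auto simp: BMO_def)
      define p where "p = (a + b) / 2"
      have p: "p \<in> J" using ab by (simp add: p_def)
      \<comment> \<open>The comparison constant treats the summands separately: the midpoint value
        for the bounded one, the mean for the other.\<close>
      define d where "d = min (?F p) k + mean ?G J"
      have osc: "\<bar>?F t - d\<bar> \<le> \<epsilon> / 4 + \<bar>?G t - mean ?G J\<bar>" if t: "t \<in> J" for t
      proof -
        have "\<bar>p - t\<bar> \<le> \<delta>" using p t ab(2) J(2) unfolding Jm by (auto simp: abs_if)
        then have "\<bar>min (?F t) k - min (?F p) k\<bar> \<le> \<epsilon> / 4"
          using eq[of t p] t p ab(3) by auto
        moreover have "?G t = max (?F t - k) 0"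
          using t ab(3) by (intro decreasing_rearrangement_truncate[OF \<Omega> r _ k]) (auto simp: measure_interval_def)
        then have "?F t = min (?F t) k + ?G t" by (simp add: max_def min_def)
        ultimately show ?thesis unfolding d_def by linarith
      qed
      have "mean_osc ?F J \<le> 2 * ((1 / measure lebesgue J) * (LINT t:J|lebesgue. \<bar>?F t - d\<bar>))"
        by (rule mean_osc_le_twice[OF JD iF])
      also have "(LINT t:J|lebesgue. \<bar>?F t - d\<bar>) \<le> \<epsilon> / 4 * measure lebesgue J + (LINT t:J|lebesgue. \<bar>?G t - mean ?G J\<bar>)"
      proof -
        have i: "integrable (lebesgue_on J) ?F" "integrable (lebesgue_on J) ?G"
          using iF iG JD(1) by (simp_all add: set_integrable_eq)
        have "(LINT t|lebesgue_on J. \<bar>?F t - d\<bar>) \<le> (LINT t|lebesgue_on J. \<epsilon> / 4 + \<bar>?G t - mean ?G J\<bar>)"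
          by (rule integral_mono) (use i osc in auto)
        also have "\<dots> = (LINT t|lebesgue_on J. \<epsilon> / 4) + (LINT t|lebesgue_on J. \<bar>?G t - mean ?G J\<bar>)"
          by (rule Bochner_Integration.integral_add) (use i in auto)
        also have "(LINT t|lebesgue_on J. \<epsilon> / 4) = \<epsilon> / 4 * measure lebesgue J"
          using JD(1) by (simp add: measure_restrict_space)
        finally show ?thesis
          unfolding set_lebesgue_integral_eq_lebesgue_on[OF JD(1)] .
      qed
      also have "2 * ((1 / measure lebesgue J) * (\<epsilon> / 4 * measure lebesgue J + (LINT t:J|lebesgue. \<bar>?G t - mean ?G J\<bar>)))
          = \<epsilon> / 2 + 2 * mean_osc ?G J"
        using JD(3) by (simp add: mean_osc_def field_simps)
      also have "mean_osc ?G J \<le> \<epsilon> / 4"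
        using order_trans[OF mean_osc_le_bmo_norm[OF J(1)] Gn] \<epsilon> by (simp add: ennreal_le_iff)
      finally show ?thesis using JD(3) by (simp add: divide_right_mono)
    qed
    then show ?thesis using \<delta> by blast
  qed
  show "?F \<in> VMO (intervals_in ?I)"
    unfolding VMO_def
  proof (intro CollectI conjI FB)
    let ?\<Phi> = "\<lambda>\<delta>::real. SUP J\<in>{J\<in>intervals_in ?I. measure lebesgue J \<le> \<delta>}. ennreal (mean_osc ?F J)"
    show "(?\<Phi> \<longlongrightarrow> 0) (at_right 0)"
    proof (rule order_tendstoI)
      fix e :: ennreal assume "0 < e"
      \<comment> \<open>The bound e may be infinite; an intermediate value is finite and supplies a
        real \<epsilon>.\<close>
      then obtain z where z: "0 < z" "z < e" using dense by blast
      obtain \<epsilon> where \<epsilon>: "0 < \<epsilon>" "ennreal \<epsilon> < e"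
      proof -
        have "z < top" using z(2) by (metis less_top order_less_le_trans top_greatest)
        then show thesis using that[of "enn2real z"] z by (simp add: enn2real_positive_iff)
      qed
      obtain \<delta> where \<delta>: "0 < \<delta>" "\<And>J. J \<in> intervals_in ?I \<Longrightarrow> measure lebesgue J \<le> \<delta> \<Longrightarrow> mean_osc ?F J \<le> \<epsilon>"
        using key[OF \<epsilon>(1)] by blast
      have "?\<Phi> d < e" if "d < \<delta>" for d
      proof -
        have "?\<Phi> d \<le> ennreal \<epsilon>"
          using that by (intro SUP_least ennreal_leI \<delta>(2)) auto
        then show ?thesis using \<epsilon>(2) by (rule le_less_trans)
      qed
      then show "eventually (\<lambda>d. ?\<Phi> d < e) (at_right 0)"
        using \<delta>(1) by (auto simp: eventually_at_right_field)
    qed simp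
  qed
qed

end
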